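(* There is a set $X \subseteq \omega^{\uparrow\omega}$ with $X \in s^0$ and $X \notin w^0$, i.e. $s^0 \setminus w^0 \neq \emptyset$.
   Context: $\omega^{\uparrow<\omega}$ denotes the set of strictly increasing finite sequences of natural numbers and $\omega^{\uparrow\omega}$ the set of strictly increasing infinite sequences (identified with infinite subsets of $\omega$ via increasing enumeration). A tree is a nonempty subset $T\subseteq\omega^{\uparrow<\omega}$ closed under initial segments; $[T]$ is its set of infinite branches in $\omega^{\uparrow\omega}$. For a family $\mathbb P$ of trees, the associated ideal consists of all $X\subseteq\omega^{\uparrow\omega}$ such that for every $T\in\mathbb P$ there is $T'\in\mathbb P$ with $T'\subseteq T$ and $[T']\cap X=\emptyset$. A Sacks tree is a tree $T$ such that every node of $T$ has an extension in $T$ with at least two immediate successors in $T$; $s^0$ is the ideal associated with Sacks trees. A willow tree is determined by a sequence $A=\{a_n;n\in\omega\}$ of nonempty finite subsets of $\omega$ with $\max a_n<\min a_{n+1}$ and a function $f:\omega\setminus\bigcup A\to 2$; it is the tree of all finite initial segments of increasing enumerations of infinite sets $x\subseteq\omega$ with $x\setminus\bigcup A=f^{-1}(\{1\})$ and, for each $n$, either $a_n\subseteq x$ or $a_n\cap x=\emptyset$; $w^0$ is the ideal associated with willow trees. *)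

theory Defs
  imports Main "HOL-Library.Infinite_Set" "HOL-Library.FuncSet" "HOL-Library.Sublist"
begin

definition inc_fin :: "nat list set" where
  "inc_fin = {s. sorted_wrt (<) s}"

definition inc_inf :: "(nat \<Rightarrow> nat) set" where
  "inc_inf = {x. strict_mono x}"

definition is_tree :: "nat list set \<Rightarrow> bool" where
  "is_tree T \<longleftrightarrow> T \<noteq> {} \<and> T \<subseteq> inc_fin \<and> (\<forall>t\<in>T. \<forall>s. prefix s t \<longrightarrow> s \<in> T)"

definition restr :: "(nat \<Rightarrow> nat) \<Rightarrow> nat \<Rightarrow> nat list" where
  "restr x k = map x [0..<k]"

definition branches :: "nat list set \<Rightarrow> (nat \<Rightarrow> nat) set" where
  "branches T = {x \<in> inc_inf. \<forall>k. restr x k \<in> T}"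

definition assoc_ideal :: "nat list set set \<Rightarrow> (nat \<Rightarrow> nat) set set" where
  "assoc_ideal P =
     {X. X \<subseteq> inc_inf \<and> (\<forall>T\<in>P. \<exists>T'\<in>P. T' \<subseteq> T \<and> branches T' \<inter> X = {})}"

definition sacks_trees :: "nat list set set" where
  "sacks_trees =
     {T. is_tree T \<and>
         (\<forall>s\<in>T. \<exists>t\<in>T. prefix s t \<and> (\<exists>m n. m \<noteq> n \<and> t @ [m] \<in> T \<and> t @ [n] \<in> T))}"

definition s0 :: "(nat \<Rightarrow> nat) set set" where
  "s0 = assoc_ideal sacks_trees"

definition block_seq :: "(nat \<Rightarrow> nat set) \<Rightarrow> bool" where
  "block_seq a \<longleftrightarrow>
     (\<forall>n. a n \<noteq> {} \<and> finite (a n)) \<and> (\<forall>n. Max (a n) < Min (a (Suc n)))"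

(* f stands for a function on the complement of the union of the blocks;
   its values inside the blocks are never used. *)
definition willow_sets :: "(nat \<Rightarrow> nat set) \<Rightarrow> (nat \<Rightarrow> nat) \<Rightarrow> nat set set" where
  "willow_sets a f =
     {x. infinite x \<and>
         x - (\<Union>n. a n) = {i \<in> UNIV - (\<Union>n. a n). f i = 1} \<and>
         (\<forall>n. a n \<subseteq> x \<or> a n \<inter> x = {})}"

definition willow_tree :: "(nat \<Rightarrow> nat set) \<Rightarrow> (nat \<Rightarrow> nat) \<Rightarrow> nat list set" where
  "willow_tree a f = {restr (enumerate x) k | x k. x \<in> willow_sets a f}"

definition willow_trees :: "nat list set set" where
  "willow_trees =
     {willow_tree a f | a f. block_seq a \<and> f \<in> (UNIV - (\<Union>n. a n)) \<rightarrow> {0, 1}}"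

definition w0 :: "(nat \<Rightarrow> nat) set set" where
  "w0 = assoc_ideal willow_trees"

end

theory Submission
  imports Defs "HOL-Analysis.Abstract_Topology_2"
begin

text \<open>
  Identify an increasing sequence with its range and colour a pair of sequences by whether the two
  ranges are comparable under inclusion. Incomparability is open, so every Sacks tree has a Sacks
  subtree that is homogeneous: its branches are pairwise comparable or pairwise incomparable.
  On the other hand every willow tree has branches \<open>z(\<xi>, t)\<close>, indexed by a square of size continuum,
  which are comparable when they have the same \<open>\<xi>\<close> and incomparable when they do not. A homogeneous
  tree therefore meets only one column of that square, or meets each column at most once, so fewer
  than continuum many homogeneous trees never cover the square. Along a well-order of length
  continuum, pick a branch of each willow tree outside all earlier homogeneous trees. The set of the
  chosen branches meets every willow tree but meets each homogeneous tree in fewer than continuum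
  many points, and these are avoided by one of continuum many disjoint Sacks subtrees.
\<close>

section \<open>Splitting schemes in Sacks trees\<close>

text \<open>An embedded full binary tree of nodes. The condition \<open>Q\<close> is imposed on
  siblings only, and siblings may first diverge beyond the end of their parent.\<close>

definition split_scheme ::
  "nat list set \<Rightarrow> (nat list \<Rightarrow> nat list \<Rightarrow> bool) \<Rightarrow> (bool list \<Rightarrow> nat list) \<Rightarrow> bool" where
  "split_scheme T Q \<psi> \<longleftrightarrow>
     (\<forall>s. \<psi> s \<in> T \<and> (\<forall>b. strict_prefix (\<psi> s) (\<psi> (s @ [b]))) \<and>
          \<psi> (s @ [False]) \<parallel> \<psi> (s @ [True]) \<and> Q (\<psi> (s @ [False])) (\<psi> (s @ [True])))"

definition scheme_tree :: "(bool list \<Rightarrow> nat list) \<Rightarrow> bool list set \<Rightarrow> nat list set" where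
  "scheme_tree \<psi> L = {t. \<exists>s\<in>L. prefix t (\<psi> s)}"

text \<open>These are the perfect subtrees of the full binary tree; thinning the index set to one of
  them keeps the Sacks property.\<close>

definition perfect_index :: "bool list set \<Rightarrow> bool" where
  "perfect_index L \<longleftrightarrow> L \<noteq> {} \<and> (\<forall>s\<in>L. \<forall>s'. prefix s' s \<longrightarrow> s' \<in> L) \<and>
     (\<forall>s\<in>L. \<exists>s'. prefix s s' \<and> s' @ [False] \<in> L \<and> s' @ [True] \<in> L)"

lemma split_scheme_exists:
  assumes T: "T \<noteq> {}"
    and split: "\<And>s. s \<in> T \<Longrightarrow> \<exists>u v. u \<in> T \<and> v \<in> T \<and> prefix s u \<and> prefix s v \<and> u \<parallel> v \<and> Q u v"
  shows "\<exists>\<psi>. split_scheme T Q \<psi>"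
proof -
  obtain r where r: "r \<in> T" using T by blast
  obtain U V where UV: "\<And>s. s \<in> T \<Longrightarrow> U s \<in> T \<and> V s \<in> T \<and> prefix s (U s) \<and> prefix s (V s) \<and>
      U s \<parallel> V s \<and> Q (U s) (V s)"
    using split by metis
  \<comment> \<open>\<open>fold\<close> reads the string from the left, so appending a bit applies
    one more choice to the node already built.\<close>
  define \<psi> where "\<psi> s = fold (\<lambda>b t. if b then V t else U t) s r" for s
  have step: "\<psi> (s @ [b]) = (if b then V (\<psi> s) else U (\<psi> s))" for s b
    by (simp add: \<psi>_def)
  have inT: "\<psi> s \<in> T" for s
    by (induction s rule: rev_induct) (use r UV step in \<open>auto simp: \<psi>_def\<close>)
  \<comment> \<open>A chosen extension equal to \<open>\<psi> s\<close> would be a prefix of the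
    other one, against parallelism.\<close>
  have "strict_prefix (\<psi> s) (U (\<psi> s))" "strict_prefix (\<psi> s) (V (\<psi> s))" for s
    using UV[OF inT[of s]] by (auto simp: strict_prefix_def)
  then have "split_scheme T Q \<psi>"
    unfolding split_scheme_def using UV inT by (simp add: step)
  then show ?thesis by blast
qed

lemma split_scheme_mono:
  assumes "split_scheme T Q \<psi>" "prefix s s'"
  shows "prefix (\<psi> s) (\<psi> s')"
proof -
  obtain d where d: "s' = s @ d" using assms(2) by (auto simp: prefix_def)
  have "prefix (\<psi> s) (\<psi> (s @ d))"
  proof (induction d rule: rev_induct)
    case (snoc b d)
    have "prefix (\<psi> (s @ d)) (\<psi> ((s @ d) @ [b]))"
      using assms(1) unfolding split_scheme_def strict_prefix_def by blast
    with snoc show ?case by (metis append_assoc prefix_order.trans)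
  qed simp
  with d show ?thesis by simp
qed

lemma split_scheme_length:
  assumes "split_scheme T Q \<psi>"
  shows "length s \<le> length (\<psi> s)"
proof (induction s rule: rev_induct)
  case (snoc b s)
  have "length (\<psi> s) < length (\<psi> (s @ [b]))"
    using assms unfolding split_scheme_def by (metis prefix_length_less)
  with snoc show ?case by simp
qed simp

text \<open>At the first bit where the strings differ the scheme has parallel siblings, and
  parallelism passes to extensions.\<close>

lemma split_scheme_parallel:
  assumes "split_scheme T Q \<psi>" "s \<noteq> s'" "length s = length s'"
  shows "\<psi> s \<parallel> \<psi> s'"
proof -
  obtain p b xs c ys where *: "b \<noteq> c" "s = p @ [b] @ xs" "s' = p @ [c] @ ys"
    using same_length_different[OF assms(2,3)] by blast
  have "prefix (\<psi> (p @ [b])) (\<psi> s)" "prefix (\<psi> (p @ [c])) (\<psi> s')"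
    using * by (auto intro!: split_scheme_mono[OF assms(1)])
  moreover have "\<psi> (p @ [b]) \<parallel> \<psi> (p @ [c])"
    using assms(1) \<open>b \<noteq> c\<close> unfolding split_scheme_def
    by (cases b; cases c) (auto simp: parallel_commute)
  ultimately show ?thesis by (metis parallel_append prefix_def)
qed

lemma scheme_tree_subset:
  assumes "is_tree T" "split_scheme T Q \<psi>"
  shows "scheme_tree \<psi> L \<subseteq> T"
  using assms unfolding is_tree_def split_scheme_def scheme_tree_def by blast

lemma scheme_tree_sacks:
  assumes T: "is_tree T" and \<psi>: "split_scheme T Q \<psi>" and L: "perfect_index L"
  shows "scheme_tree \<psi> L \<in> sacks_trees"
proof -
  let ?G = "scheme_tree \<psi> L"
  have "is_tree ?G"
  proof -
    have "?G \<noteq> {}" using L unfolding perfect_index_def scheme_tree_def by blast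
    moreover have "?G \<subseteq> inc_fin"
      using scheme_tree_subset[OF T \<psi>] T unfolding is_tree_def by blast
    moreover have "\<forall>t\<in>?G. \<forall>s. prefix s t \<longrightarrow> s \<in> ?G"
      unfolding scheme_tree_def by (blast intro: prefix_order.trans)
    ultimately show ?thesis unfolding is_tree_def by blast
  qed
  moreover have "\<exists>w\<in>?G. prefix t w \<and> (\<exists>m n. m \<noteq> n \<and> w @ [m] \<in> ?G \<and> w @ [n] \<in> ?G)"
    if t: "t \<in> ?G" for t
  proof -
    obtain s where s: "s \<in> L" "prefix t (\<psi> s)" using t unfolding scheme_tree_def by blast
    obtain s' where s': "prefix s s'" "s' @ [False] \<in> L" "s' @ [True] \<in> L"
      using L s(1) unfolding perfect_index_def by blast
    have "\<psi> (s' @ [False]) \<parallel> \<psi> (s' @ [True])" using \<psi> unfolding split_scheme_def by blast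
    \<comment> \<open>The splitting node sought is \<open>w\<close>, where the two sibling nodes
      diverge; it may be longer than \<open>\<psi> s'\<close>.\<close>
    then obtain w b bs c cs where w: "b \<noteq> c" "\<psi> (s' @ [False]) = w @ b # bs"
        "\<psi> (s' @ [True]) = w @ c # cs"
      using parallel_decomp by blast
    have "prefix (\<psi> s) (\<psi> (s' @ [x]))" for x
      using s'(1) by (intro split_scheme_mono[OF \<psi>]) (auto simp: prefix_def)
    then have tt: "prefix t (w @ b # bs)" "prefix t (w @ c # cs)"
      using s(2) w(2,3) by (metis prefix_order.trans)+
    have "prefix t w"
      using tt w(1) by (auto simp: prefix_append prefix_Cons)
    moreover have "w @ [b] \<in> ?G" "w @ [c] \<in> ?G" "w \<in> ?G"
      unfolding scheme_tree_def using w s' by (force simp: prefix_def)+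
    ultimately show ?thesis using w(1) by blast
  qed
  ultimately show ?thesis unfolding sacks_trees_def by blast
qed

lemma prefix_restr_mono: "m \<le> n \<Longrightarrow> prefix (restr x m) (restr x n)"
  unfolding restr_def by (metis le_add_diff_inverse map_append prefixI upt_add_eq_append zero_le)

lemma length_restr [simp]: "length (restr x n) = n"
  by (simp add: restr_def)

text \<open>There are finitely many binary strings of length at most \<open>n\<close>, so some
  \<open>k\<close> bounds the lengths of their images. An initial segment of \<open>x\<close> longer
  than \<open>k\<close> can only lie below the image of a string longer than \<open>n\<close>, and
  that string is cut back to length \<open>n\<close>.\<close>

lemma scheme_tree_branch:
  assumes \<psi>: "split_scheme T Q \<psi>" and L: "perfect_index L"
    and x: "x \<in> branches (scheme_tree \<psi> L)"
  shows "\<exists>s\<in>L. length s = n \<and> prefix (\<psi> s) (restr x (length (\<psi> s)))"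
proof -
  define k where "k = Max ((\<lambda>s. length (\<psi> s)) ` {s. length s \<le> n})"
  have fin: "finite {s :: bool list. length s \<le> n}"
    using finite_lists_length_le[of "UNIV :: bool set" n] by simp
  have k: "length (\<psi> s) \<le> k" if "length s \<le> n" for s
    unfolding k_def using fin that by (intro Max_ge) auto
  obtain s where s: "s \<in> L" "prefix (restr x (Suc k)) (\<psi> s)"
    using x unfolding branches_def scheme_tree_def by blast
  have "Suc k \<le> length (\<psi> s)" using prefix_length_le[OF s(2)] by simp
  then have n: "n \<le> length s" using k[of s] by linarith
  let ?s = "take n s"
  have 1: "prefix (\<psi> ?s) (\<psi> s)" using take_is_prefix by (intro split_scheme_mono[OF \<psi>])
  have len: "length (\<psi> ?s) \<le> k" using k by simp
  have "prefix (restr x (length (\<psi> ?s))) (\<psi> s)"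
    using prefix_restr_mono[of "length (\<psi> ?s)" "Suc k" x] len s(2) by (metis le_SucI prefix_order.trans)
  then have "prefix (\<psi> ?s) (restr x (length (\<psi> ?s)))"
    using 1 prefix_length_prefix by fastforce
  moreover have "?s \<in> L" using L s(1) take_is_prefix unfolding perfect_index_def by blast
  ultimately show ?thesis using n by (intro bexI[of _ ?s]) auto
qed

lemma prefix_restr_iff: "prefix u (restr x (length u)) \<longleftrightarrow> u = restr x (length u)"
  by (metis length_restr prefix_order.refl prefix_length_prefix prefix_order.antisym order_refl)

lemma scheme_tree_branch_eq:
  assumes \<psi>: "split_scheme T Q \<psi>" and L: "perfect_index L"
    and x: "x \<in> branches (scheme_tree \<psi> L)"
  shows "\<exists>s\<in>L. length s = n \<and> \<psi> s = restr x (length (\<psi> s))"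
  using scheme_tree_branch[OF assms] prefix_restr_iff by metis

lemma restr_not_parallel: "\<not> restr x m \<parallel> restr x n"
  using prefix_restr_mono nat_le_linear by (metis parallelD1 parallelD2)

lemma sacks_parallel:
  assumes "T \<in> sacks_trees" "s \<in> T"
  shows "\<exists>u v. u \<in> T \<and> v \<in> T \<and> prefix s u \<and> prefix s v \<and> u \<parallel> v"
proof -
  obtain t m n where "t \<in> T" "prefix s t" "m \<noteq> n" "t @ [m] \<in> T" "t @ [n] \<in> T"
    using assms unfolding sacks_trees_def by blast
  then show ?thesis
    by (intro exI[of _ "t @ [m]"] exI[of _ "t @ [n]"]) auto
qed

section \<open>Continuum many disjoint Sacks subtrees\<close>

text \<open>Even positions code the set and keep different sets apart; odd positions are free and
  supply the splitting.\<close>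

definition even_index :: "nat set \<Rightarrow> bool list set" where
  "even_index \<xi> = {s. \<forall>i. 2 * i < length s \<longrightarrow> (s ! (2 * i) \<longleftrightarrow> i \<in> \<xi>)}"

lemma perfect_even_index: "perfect_index (even_index \<xi>)"
proof -
  have "[] \<in> even_index \<xi>" by (simp add: even_index_def)
  moreover have "s' \<in> even_index \<xi>" if "s \<in> even_index \<xi>" "prefix s' s" for s s'
    using that by (force simp: even_index_def prefix_def nth_append)
  moreover have "\<exists>s'. prefix s s' \<and> s' @ [False] \<in> even_index \<xi> \<and> s' @ [True] \<in> even_index \<xi>"
    if s: "s \<in> even_index \<xi>" for s
  proof -
    have odd: "s' @ [b] \<in> even_index \<xi>" if "s' \<in> even_index \<xi>" "odd (length s')" for s' b
      using that by (auto simp: even_index_def nth_append less_Suc_eq) (metis dvd_triv_left)+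
    show ?thesis
    proof (cases "even (length s)")
      case True
      let ?s = "s @ [length s div 2 \<in> \<xi>]"
      have "?s \<in> even_index \<xi>" using s True
        by (auto simp: even_index_def nth_append less_Suc_eq)
      then show ?thesis using True odd[of ?s] by (intro exI[of _ ?s]) auto
    next
      case False
      then show ?thesis using s odd by (intro exI[of _ s]) auto
    qed
  qed
  ultimately show ?thesis unfolding perfect_index_def by blast
qed

text \<open>A common branch of two subtrees would pass through the images of two strings that
  disagree at an even position, and such images are parallel.\<close>

lemma sacks_disjoint_subtrees:
  assumes T: "T \<in> sacks_trees"
  shows "\<exists>G :: nat set \<Rightarrow> nat list set.
    (\<forall>\<xi>. G \<xi> \<in> sacks_trees \<and> G \<xi> \<subseteq> T) \<and> (\<forall>\<xi> \<zeta>. \<xi> \<noteq> \<zeta> \<longrightarrow> branches (G \<xi>) \<inter> branches (G \<zeta>) = {})"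
proof -
  have tree: "is_tree T" using T unfolding sacks_trees_def by blast
  then have "T \<noteq> {}" unfolding is_tree_def by blast
  then obtain \<psi> where \<psi>: "split_scheme T (\<lambda>_ _. True) \<psi>"
    using split_scheme_exists[of T "\<lambda>_ _. True"] sacks_parallel[OF T] by blast
  let ?G = "\<lambda>\<xi>. scheme_tree \<psi> (even_index \<xi>)"
  have "branches (?G \<xi>) \<inter> branches (?G \<zeta>) = {}" if ne: "\<xi> \<noteq> \<zeta>" for \<xi> \<zeta>
  proof (rule ccontr)
    assume "\<not> ?thesis"
    then obtain x where x: "x \<in> branches (?G \<xi>)" "x \<in> branches (?G \<zeta>)" by blast
    obtain i where i: "\<not> (i \<in> \<xi> \<longleftrightarrow> i \<in> \<zeta>)" using ne by blast
    \<comment> \<open>\<open>Suc (2 * i)\<close> is the least length at which the bit coding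
      \<open>i\<close> is present.\<close>
    obtain s where s: "s \<in> even_index \<xi>" "length s = Suc (2 * i)" "\<psi> s = restr x (length (\<psi> s))"
      using scheme_tree_branch_eq[OF \<psi> perfect_even_index x(1)] by blast
    obtain s' where s': "s' \<in> even_index \<zeta>" "length s' = Suc (2 * i)" "\<psi> s' = restr x (length (\<psi> s'))"
      using scheme_tree_branch_eq[OF \<psi> perfect_even_index x(2)] by blast
    have "s \<noteq> s'" using s(1,2) s'(1,2) i by (auto simp: even_index_def)
    then have "\<psi> s \<parallel> \<psi> s'" using split_scheme_parallel[OF \<psi>] s(2) s'(2) by simp
    then show False using s(3) s'(3) restr_not_parallel by metis
  qed
  then show ?thesis
    using scheme_tree_sacks[OF tree \<psi> perfect_even_index] scheme_tree_subset[OF tree \<psi>]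
    by (intro exI[of _ ?G]) blast
qed

section \<open>Homogeneous Sacks trees\<close>

definition comparable :: "(nat \<Rightarrow> nat) \<Rightarrow> (nat \<Rightarrow> nat) \<Rightarrow> bool" where
  "comparable x y \<longleftrightarrow> range x \<subseteq> range y \<or> range y \<subseteq> range x"

lemma comparable_sym: "comparable x y \<longleftrightarrow> comparable y x"
  by (auto simp: comparable_def)

definition homogeneous :: "nat list set \<Rightarrow> bool" where
  "homogeneous T \<longleftrightarrow>
     (\<forall>x\<in>branches T. \<forall>y\<in>branches T. comparable x y) \<or>
     (\<forall>x\<in>branches T. \<forall>y\<in>branches T. x \<noteq> y \<longrightarrow> \<not> comparable x y)"

definition extends :: "(nat \<Rightarrow> nat) \<Rightarrow> nat list \<Rightarrow> bool" where
  "extends x u \<longleftrightarrow> strict_mono x \<and> u = restr x (length u)"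

definition incomparable_nodes :: "nat list \<Rightarrow> nat list \<Rightarrow> bool" where
  "incomparable_nodes u v \<longleftrightarrow> (\<forall>x y. extends x u \<and> extends y v \<longrightarrow> \<not> comparable x y)"

lemma extends_nth: "extends x u \<Longrightarrow> i < length u \<Longrightarrow> u ! i = x i"
  unfolding extends_def restr_def by (metis add_0 length_map length_upt minus_nat.diff_0 nth_map_upt)

text \<open>This is the openness of incomparability. An increasing sequence can take the value
  \<open>p\<close> only at an index at most \<open>p\<close>, so its first \<open>k > p\<close>
  terms decide whether \<open>p\<close> is in its range.\<close>

lemma incomparable_nodes_if_incomparable:
  assumes x: "strict_mono x" and y: "strict_mono y" and xy: "\<not> comparable x y"
  shows "\<exists>k0. \<forall>k\<ge>k0. incomparable_nodes (restr x k) (restr y k)"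
proof -
  obtain p q where pq: "p \<in> range x" "p \<notin> range y" "q \<in> range y" "q \<notin> range x"
    using xy unfolding comparable_def by blast
  have local: "p \<in> range x' \<longleftrightarrow> p \<in> range x" 
    if "strict_mono x" "extends x' (restr x k)" "p < k" for x x' k p
  proof -
    have eq: "x' i = x i" if "i < k" for i
      using extends_nth[OF \<open>extends x' (restr x k)\<close>, of i] that by (simp add: restr_def)
    have "i < k" if "z i = p" "strict_mono z" for i and z :: "nat \<Rightarrow> nat"
      using strict_mono_imp_increasing[OF that(2), of i] that(1) \<open>p < k\<close> by simp
    moreover have "strict_mono x'" using that(2) by (simp add: extends_def)
    ultimately show ?thesis using eq that(1) by (metis (no_types, lifting) image_iff rangeI)
  qed
  have "incomparable_nodes (restr x k) (restr y k)" if "Suc (max p q) \<le> k" for k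
  proof -
    have "p < k" "q < k" using that by auto
    then show ?thesis
      unfolding incomparable_nodes_def comparable_def
      using local[OF x] local[OF y] pq by (meson subsetD)
  qed
  then show ?thesis by blast
qed

text \<open>Two incomparable branches of the cone at \<open>s\<close> would, by openness, have long
  initial segments that are parallel incomparable nodes above \<open>s\<close>, which
  \<open>none\<close> excludes.\<close>

lemma homogeneous_if_comparable_cone:
  assumes T: "T \<in> sacks_trees" and s: "s \<in> T"
    and none: "\<And>u v. u \<in> T \<Longrightarrow> v \<in> T \<Longrightarrow> prefix s u \<Longrightarrow> prefix s v \<Longrightarrow> u \<parallel> v \<Longrightarrow>
      \<not> incomparable_nodes u v"
  shows "\<exists>S\<in>sacks_trees. S \<subseteq> T \<and> homogeneous S"
proof -
  let ?S = "{t \<in> T. prefix t s \<or> prefix s t}"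
  have tree: "is_tree T" using T unfolding sacks_trees_def by blast
  have "is_tree ?S"
    using tree s unfolding is_tree_def
    by (auto intro: prefix_order.trans) (metis prefix_order.trans prefix_same_cases)
  moreover have "\<exists>w\<in>?S. prefix t w \<and> (\<exists>m n. m \<noteq> n \<and> w @ [m] \<in> ?S \<and> w @ [n] \<in> ?S)"
    if t: "t \<in> ?S" for t
  proof -
    obtain t' where t': "t' \<in> T" "prefix s t'" "prefix t t'"
      using t s by blast
    obtain w m n where w: "w \<in> T" "prefix t' w" "m \<noteq> n" "w @ [m] \<in> T" "w @ [n] \<in> T"
      using T t'(1) unfolding sacks_trees_def by blast
    have "prefix s w" "prefix t w" using t' w(2) by (auto intro: prefix_order.trans)
    then show ?thesis using w by (intro bexI[of _ w]) auto
  qed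
  ultimately have "?S \<in> sacks_trees" unfolding sacks_trees_def by blast
  moreover have "homogeneous ?S"
  proof -
    have "comparable x y" if x: "x \<in> branches ?S" and y: "y \<in> branches ?S" for x y
    proof (rule ccontr)
      assume n: "\<not> comparable x y"
      have mono: "strict_mono x" "strict_mono y" using x y by (auto simp: branches_def inc_inf_def)
      obtain k0 where k0: "\<And>k. k \<ge> k0 \<Longrightarrow> incomparable_nodes (restr x k) (restr y k)"
        using incomparable_nodes_if_incomparable[OF mono n] by blast
      obtain i where i: "x i \<noteq> y i" using n unfolding comparable_def by fastforce
      \<comment> \<open>The three summands make the initial segments incomparable nodes, longer than
        \<open>s\<close>, and different at position \<open>i\<close>.\<close>
      define k where "k = Suc (k0 + length s + i)"
      have "i < k" by (simp add: k_def)
      then have "restr x k \<noteq> restr y k" using i by (auto simp: restr_def)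
      then have "restr x k \<parallel> restr y k"
        by (metis length_restr not_equal_is_parallel)
      moreover have "prefix s (restr z k)" if "z \<in> branches ?S" for z
      proof -
        have "prefix (restr z k) s \<or> prefix s (restr z k)" using that by (auto simp: branches_def)
        moreover have "\<not> prefix (restr z k) s" using prefix_length_le[of "restr z k" s] by (auto simp: k_def)
        ultimately show ?thesis by blast
      qed
      moreover have "restr x k \<in> T" "restr y k \<in> T" using x y by (auto simp: branches_def)
      ultimately have "\<not> incomparable_nodes (restr x k) (restr y k)" using none x y by blast
      then show False using k0[of k] by (simp add: k_def)
    qed
    then show ?thesis unfolding homogeneous_def by simp
  qed
  ultimately show ?thesis by (intro bexI[of _ ?S]) auto
qed

text \<open>Distinct branches follow distinct strings, and they extend the incomparable siblings at
  which these strings first part.\<close>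

lemma homogeneous_if_incomparable_scheme:
  assumes T: "is_tree T" and \<psi>: "split_scheme T incomparable_nodes \<psi>"
  shows "homogeneous (scheme_tree \<psi> UNIV)"
proof -
  have L: "perfect_index UNIV" by (auto simp: perfect_index_def)
  have "\<not> comparable x y"
    if x: "x \<in> branches (scheme_tree \<psi> UNIV)" and y: "y \<in> branches (scheme_tree \<psi> UNIV)"
      and ne: "x \<noteq> y" for x y
  proof -
    have mono: "strict_mono x" "strict_mono y" using x y by (auto simp: branches_def inc_inf_def)
    obtain i where i: "x i \<noteq> y i" using ne by blast
    \<comment> \<open>At level \<open>Suc i\<close> the image has more than \<open>i\<close>
      entries, so it records \<open>x i\<close>.\<close>
    obtain s where s: "length s = Suc i" "\<psi> s = restr x (length (\<psi> s))"
      using scheme_tree_branch_eq[OF \<psi> L x] by blast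
    obtain s' where s': "length s' = Suc i" "\<psi> s' = restr y (length (\<psi> s'))"
      using scheme_tree_branch_eq[OF \<psi> L y] by blast
    have ex: "extends x (\<psi> s)" "extends y (\<psi> s')" using s s' mono by (auto simp: extends_def)
    have len: "i < length (\<psi> s)" "i < length (\<psi> s')"
      using split_scheme_length[OF \<psi>] s(1) s'(1) by (metis Suc_le_eq)+
    have "s \<noteq> s'" using extends_nth[OF ex(1) len(1)] extends_nth[OF ex(2) len(2)] i by auto
    then obtain p b xs c ys where *: "b \<noteq> c" "s = p @ [b] @ xs" "s' = p @ [c] @ ys"
      using same_length_different[OF _ trans[OF s(1) s'(1)[symmetric]]] by blast
    have "extends z u" if "extends z v" "prefix u v" for z u v
      using that prefix_restr_mono[of "length u" "length v" z] prefix_length_le[OF that(2)]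
      unfolding extends_def by (metis length_restr prefix_length_prefix prefix_order.antisym order_refl)
    moreover have "prefix (\<psi> (p @ [b])) (\<psi> s)" "prefix (\<psi> (p @ [c])) (\<psi> s')"
      using * by (auto intro!: split_scheme_mono[OF \<psi>])
    ultimately have ext: "extends x (\<psi> (p @ [b]))" "extends y (\<psi> (p @ [c]))"
      using ex by blast+
    have "incomparable_nodes (\<psi> (p @ [False])) (\<psi> (p @ [True]))"
      using \<psi> unfolding split_scheme_def by blast
    then show ?thesis
      using ext \<open>b \<noteq> c\<close> unfolding incomparable_nodes_def by (metis (full_types) comparable_sym)
  qed
  then show ?thesis unfolding homogeneous_def by blast
qed

text \<open>Either every node has parallel incomparable extensions, and a scheme of them yields an
  antichain of branches, or some node has none, and the branches of its cone form a chain.\<close>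

lemma homogeneous_dense:
  assumes T: "T \<in> sacks_trees"
  shows "\<exists>S\<in>sacks_trees. S \<subseteq> T \<and> homogeneous S"
proof (cases "\<forall>s\<in>T. \<exists>u v. u \<in> T \<and> v \<in> T \<and> prefix s u \<and> prefix s v \<and> u \<parallel> v \<and> incomparable_nodes u v")
  case True
  have tree: "is_tree T" using T unfolding sacks_trees_def by blast
  then have "T \<noteq> {}" unfolding is_tree_def by blast
  then obtain \<psi> where \<psi>: "split_scheme T incomparable_nodes \<psi>"
    using split_scheme_exists True by blast
  have "perfect_index UNIV" by (auto simp: perfect_index_def)
  then show ?thesis
    using scheme_tree_sacks[OF tree \<psi>] scheme_tree_subset[OF tree \<psi>]
      homogeneous_if_incomparable_scheme[OF tree \<psi>] by blast
next
  case False
  then show ?thesis using homogeneous_if_comparable_cone[OF T] by blast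
qed

section \<open>A square of branches of a willow tree\<close>

lemma block_seq_less:
  assumes "block_seq a" "m < n" "i \<in> a m" "j \<in> a n"
  shows "i < j"
proof -
  have *: "a n \<noteq> {}" "finite (a n)" "Max (a n) < Min (a (Suc n))" for n
    using assms(1) unfolding block_seq_def by auto
  have "Max (a m) < Min (a n)" using assms(2)
  proof (induction n)
    case (Suc n)
    have "Min (a n) \<le> Max (a n)" using * by (meson Max_ge Min_in)
    with Suc *(3)[of n] *(3)[of m] show ?case by (cases "m = n") auto
  qed simp
  then show ?thesis using * assms(3,4) by (meson Max_ge Min_le le_less_trans less_le_trans)
qed

lemma block_seq_disjoint: "block_seq a \<Longrightarrow> i \<in> a m \<Longrightarrow> i \<in> a n \<Longrightarrow> m = n"
  using block_seq_less less_irrefl nat_neq_iff by metis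

definition willow_point :: "(nat \<Rightarrow> nat set) \<Rightarrow> (nat \<Rightarrow> nat) \<Rightarrow> nat set \<Rightarrow> nat set" where
  "willow_point a f C = {i \<in> UNIV - (\<Union>n. a n). f i = 1} \<union> (\<Union>n\<in>C. a n)"

text \<open>Blocks are nonempty and pairwise disjoint, so a single element of a block reveals
  whether its index was chosen.\<close>

lemma willow_point_subset_iff:
  assumes "block_seq a"
  shows "willow_point a f C \<subseteq> willow_point a f C' \<longleftrightarrow> C \<subseteq> C'"
proof
  assume sub: "willow_point a f C \<subseteq> willow_point a f C'"
  show "C \<subseteq> C'"
  proof
    fix n assume n: "n \<in> C"
    obtain i where i: "i \<in> a n" using assms unfolding block_seq_def by blast
    then have "i \<in> willow_point a f C'" using n sub unfolding willow_point_def by blast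
    then obtain m where "m \<in> C'" "i \<in> a m" using i unfolding willow_point_def by blast
    then show "n \<in> C'" using block_seq_disjoint[OF assms i] by simp
  qed
qed (auto simp: willow_point_def)

lemma willow_point_in_sets:
  assumes a: "block_seq a" and C: "infinite C"
  shows "willow_point a f C \<in> willow_sets a f"
proof -
  have ne: "a n \<noteq> {}" "finite (a n)" for n using a unfolding block_seq_def by auto
  have in_a: "Min (a n) \<in> a n" for n using ne by simp
  \<comment> \<open>The minima of the chosen blocks are distinct, which makes the set infinite even
    when \<open>f\<close> contributes finitely many elements.\<close>
  have "inj_on (\<lambda>n. Min (a n)) C"
    using in_a block_seq_disjoint[OF a] by (metis inj_onI)
  then have "infinite ((\<lambda>n. Min (a n)) ` C)" using C finite_imageD by blast
  moreover have "(\<lambda>n. Min (a n)) ` C \<subseteq> willow_point a f C" using in_a by (auto simp: willow_point_def)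
  ultimately have "infinite (willow_point a f C)" using finite_subset by blast
  moreover have "a n \<subseteq> willow_point a f C \<or> a n \<inter> willow_point a f C = {}" for n
  proof (cases "n \<in> C")
    case False
    then have "i \<notin> willow_point a f C" if "i \<in> a n" for i
      using that block_seq_disjoint[OF a that] unfolding willow_point_def by blast
    then show ?thesis by blast
  next
    case True
    then show ?thesis unfolding willow_point_def by blast
  qed
  moreover have "willow_point a f C - (\<Union>n. a n) = {i \<in> UNIV - (\<Union>n. a n). f i = 1}"
    unfolding willow_point_def by blast
  ultimately show ?thesis unfolding willow_sets_def by blast
qed

lemma enumerate_branch:
  assumes "x \<in> willow_sets a f"
  shows "enumerate x \<in> branches (willow_tree a f)" "range (enumerate x) = x"
proof -
  have inf: "infinite x" using assms unfolding willow_sets_def by blast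
  then show "range (enumerate x) = x" by (rule range_enumerate)
  show "enumerate x \<in> branches (willow_tree a f)"
    using assms inf unfolding branches_def inc_inf_def willow_tree_def
    by (auto intro: strict_mono_enumerate)
qed

text \<open>
  Residues 0 and 1 modulo 3 code \<open>\<xi>\<close> so that different \<open>\<xi>\<close> give incomparable sets. Residue 2 codes
  the lower rational cut of \<open>t\<close>, and these cuts form a chain.
\<close>
definition square_code :: "nat set \<Rightarrow> real \<Rightarrow> nat set" where
  "square_code \<xi> t = {n. if n mod 3 = 0 then n div 3 \<in> \<xi>
                         else if n mod 3 = 1 then n div 3 \<notin> \<xi>
                         else real_of_rat (from_nat (n div 3)) < t}"

lemma div_mod_3:
  fixes i :: nat
  shows "Suc (3 * i) div 3 = i" "Suc (Suc (3 * i)) div 3 = i"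
    "Suc (3 * i) mod 3 = 1" "Suc (Suc (3 * i)) mod 3 = 2"
  by presburger+

text \<open>For every \<open>m\<close> exactly one of \<open>3 * m\<close> and
  \<open>3 * m + 1\<close> belongs to the set.\<close>

lemma infinite_square_code: "infinite (square_code \<xi> t)"
proof -
  have "\<exists>n\<in>square_code \<xi> t. m \<le> n" for m
    by (rule bexI[of _ "if m \<in> \<xi> then 3 * m else 3 * m + 1"]) (auto simp: square_code_def div_mod_3)
  then show ?thesis by (metis infinite_nat_iff_unbounded_le)
qed

text \<open>Residue 0 gives inclusion of \<open>\<xi>\<close> in \<open>\<zeta>\<close>, and residue
  1 gives inclusion of their complements.\<close>

lemma square_code_subset_fst:
  assumes "square_code \<xi> t \<subseteq> square_code \<zeta> u"
  shows "\<xi> = \<zeta>"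
proof -
  have code: "3 * i \<in> square_code \<xi> t \<longleftrightarrow> i \<in> \<xi>" "3 * i + 1 \<in> square_code \<xi> t \<longleftrightarrow> i \<notin> \<xi>" for \<xi> t i
    by (auto simp: square_code_def div_mod_3)
  have "i \<in> \<xi> \<longleftrightarrow> i \<in> \<zeta>" for i
    using code[of i] subsetD[OF assms, of "3 * i"] subsetD[OF assms, of "3 * i + 1"] by blast
  then show ?thesis by blast
qed

lemma square_code_mono: "t \<le> u \<Longrightarrow> square_code \<xi> t \<subseteq> square_code \<xi> u"
  by (auto simp: square_code_def split: if_splits)

text \<open>A rational strictly between two reals lies in the cut of the larger one only.\<close>

lemma square_code_inj_snd:
  assumes "square_code \<xi> t = square_code \<xi> u"
  shows "t = u"
proof (rule ccontr)
  have code: "3 * i + 2 \<in> square_code \<xi> t \<longleftrightarrow> real_of_rat (from_nat i) < t" for i t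
    by (simp add: square_code_def div_mod_3)
  have False if less: "t < u" and eq: "square_code \<xi> t = square_code \<xi> u" for t u
  proof -
    obtain q where q: "t < real_of_rat q" "real_of_rat q < u" using of_rat_dense[OF less] by blast
    have "real_of_rat (from_nat (to_nat q)) < t \<longleftrightarrow> real_of_rat (from_nat (to_nat q)) < u"
      using code[of "to_nat q"] eq by metis
    then show False using q by simp
  qed
  moreover assume "t \<noteq> u"
  ultimately show False using assms by (metis linorder_less_linear)
qed

lemma willow_square:
  assumes "W \<in> willow_trees"
  obtains z :: "nat set \<Rightarrow> real \<Rightarrow> nat \<Rightarrow> nat" where
    "\<And>\<xi> t. z \<xi> t \<in> branches W"
    "\<And>\<xi> t u. comparable (z \<xi> t) (z \<xi> u)"
    "\<And>\<xi> t u. z \<xi> t = z \<xi> u \<Longrightarrow> t = u"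
    "\<And>\<xi> \<zeta> t u. comparable (z \<xi> t) (z \<zeta> u) \<Longrightarrow> \<xi> = \<zeta>"
proof -
  obtain a f where a: "W = willow_tree a f" "block_seq a"
    using assms unfolding willow_trees_def by blast
  let ?p = "\<lambda>\<xi> t. willow_point a f (square_code \<xi> t)"
  let ?z = "\<lambda>\<xi> t. enumerate (?p \<xi> t)"
  have branch: "?z \<xi> t \<in> branches W" and range: "range (?z \<xi> t) = ?p \<xi> t" for \<xi> t
    using enumerate_branch[OF willow_point_in_sets[OF a(2) infinite_square_code]] a(1) by auto
  have sub: "range (?z \<xi> t) \<subseteq> range (?z \<zeta> u) \<longleftrightarrow> square_code \<xi> t \<subseteq> square_code \<zeta> u" for \<xi> \<zeta> t u
    unfolding range by (rule willow_point_subset_iff[OF a(2)])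
  have comp: "comparable (?z \<xi> t) (?z \<xi> u)" for \<xi> t u
    unfolding comparable_def sub using linear[of t u] square_code_mono by auto
  have inj: "t = u" if "?z \<xi> t = ?z \<xi> u" for \<xi> t u
    using sub[of \<xi> t \<xi> u] sub[of \<xi> u \<xi> t] that by (metis square_code_inj_snd subset_antisym order_refl)
  have diff: "\<xi> = \<zeta>" if "comparable (?z \<xi> t) (?z \<zeta> u)" for \<xi> \<zeta> t u
    using that square_code_subset_fst unfolding comparable_def sub by blast
  show thesis by (rule that[of ?z, OF branch comp inj diff])
qed

section \<open>Counting\<close>

unbundle cardinal_syntax

text \<open>If sets with at most one element each covered the type, sending a point to an index of a
  set containing it would be injective.\<close>

lemma small_union_misses_point:
  fixes B :: "'k \<Rightarrow> 'b set"
  assumes K: "|K| <o |UNIV :: 'b set|"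
    and B: "\<And>k x y. k \<in> K \<Longrightarrow> x \<in> B k \<Longrightarrow> y \<in> B k \<Longrightarrow> x = y"
  shows "\<exists>x. \<forall>k\<in>K. x \<notin> B k"
proof (rule ccontr)
  assume "\<not> ?thesis"
  then obtain g where g: "\<And>x. g x \<in> K \<and> x \<in> B (g x)" by metis
  then have "inj g" using B by (metis injI)
  then have "|UNIV :: 'b set| \<le>o |K|" using g card_of_ordLeq[of UNIV K] by blast
  then show False using K not_ordLess_ordLeq by blast
qed

lemma card_of_nat_sets_eq_reals: "|UNIV :: nat set set| =o |UNIV :: real set|"
  using nat_sets_eqpoll_reals card_of_ordIso unfolding eqpoll_def by blast

text \<open>The counting is applied twice. Each chain tree meets at most one column, so some column
  \<open>\<xi>\<close> avoids all chain trees in \<open>K\<close>; every other tree in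
  \<open>K\<close> is an antichain and meets this column, itself a chain, at most once.\<close>

lemma small_homogeneous_miss_willow:
  assumes W: "W \<in> willow_trees" and K: "|K| <o |UNIV :: nat set set|"
    and hom: "\<And>S. S \<in> K \<Longrightarrow> homogeneous S"
  shows "\<exists>x\<in>branches W. \<forall>S\<in>K. x \<notin> branches S"
proof -
  obtain z :: "nat set \<Rightarrow> real \<Rightarrow> nat \<Rightarrow> nat" where z: "\<And>\<xi> t. z \<xi> t \<in> branches W"
    and same: "\<And>\<xi> t u. comparable (z \<xi> t) (z \<xi> u)"
    and inj: "\<And>\<xi> t u. z \<xi> t = z \<xi> u \<Longrightarrow> t = u"
    and diff: "\<And>\<xi> \<zeta> t u. comparable (z \<xi> t) (z \<zeta> u) \<Longrightarrow> \<xi> = \<zeta>"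
    by (rule willow_square[OF W], rule that)
  define chain where "chain S \<longleftrightarrow> (\<forall>x\<in>branches S. \<forall>y\<in>branches S. comparable x y)" for S
  have "\<exists>\<xi>. \<forall>S\<in>K. \<xi> \<notin> {\<xi>. chain S \<and> (\<exists>t. z \<xi> t \<in> branches S)}"
    by (rule small_union_misses_point[OF K]) (unfold chain_def, blast dest: diff)
  then obtain \<xi> where \<xi>: "\<And>S t. S \<in> K \<Longrightarrow> chain S \<Longrightarrow> z \<xi> t \<notin> branches S" by blast
  have K': "|K| <o |UNIV :: real set|"
    using K card_of_nat_sets_eq_reals by (rule ordLess_ordIso_trans)
  have "t = u" if "S \<in> K" "z \<xi> t \<in> branches S" "z \<xi> u \<in> branches S" for S t u
    using \<xi> that hom[OF that(1)] same inj unfolding homogeneous_def chain_def by metis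
  then have "\<exists>t. \<forall>S\<in>K. t \<notin> {t. z \<xi> t \<in> branches S}"
    by (intro small_union_misses_point[OF K']) auto
  then show ?thesis using z by blast
qed

text \<open>Each point \<open>p k\<close> is a branch of at most one of the disjoint subtrees, so
  \<open>K\<close> spoils too few of them.\<close>

lemma sacks_subtree_avoids_small:
  assumes T: "T \<in> sacks_trees" and K: "|K| <o |UNIV :: nat set set|"
  shows "\<exists>S\<in>sacks_trees. S \<subseteq> T \<and> branches S \<inter> p ` K = {}"
proof -
  obtain G :: "nat set \<Rightarrow> nat list set" where G: "\<And>\<xi>. G \<xi> \<in> sacks_trees \<and> G \<xi> \<subseteq> T"
    and disj: "\<And>\<xi> \<zeta>. \<xi> \<noteq> \<zeta> \<Longrightarrow> branches (G \<xi>) \<inter> branches (G \<zeta>) = {}"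
    using sacks_disjoint_subtrees[OF T] by blast
  have "\<exists>\<xi>. \<forall>k\<in>K. \<xi> \<notin> {\<xi>. p k \<in> branches (G \<xi>)}"
    by (rule small_union_misses_point[OF K]) (use disj in blast)
  then show ?thesis using G by blast
qed

text \<open>The cardinal of a type is itself a well-order of minimal length, so its proper initial
  segments are smaller; sets of finite lists number at most continuum because lists are
  countable.\<close>

lemma wellorder_with_small_segments:
  obtains R :: "nat list set rel" where "\<And>S T. S = T \<or> (S, T) \<in> R \<or> (T, S) \<in> R"
    "\<And>T. |{S. (S, T) \<in> R \<and> S \<noteq> T}| <o |UNIV :: nat set set|"
proof -
  let ?r = "|UNIV :: nat list set set|"
  have "total ?r"
    using card_of_well_order_on[of "UNIV :: nat list set set"]
    unfolding well_order_on_def linear_order_on_def by simp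
  then have total: "S = T \<or> (S, T) \<in> ?r \<or> (T, S) \<in> ?r" for S T by (auto simp: total_on_def)
  have small: "|{S. (S, T) \<in> ?r \<and> S \<noteq> T}| <o |UNIV :: nat set set|" for T
  proof -
    have less: "|underS ?r T| <o ?r" by (intro card_of_underS card_of_Card_order) (simp add: Field_card_of)
    have "inj ((`) (to_nat :: nat list \<Rightarrow> nat))" by (simp add: inj_image_eq_iff inj_on_def)
    then have le: "?r \<le>o |UNIV :: nat set set|" by (metis card_of_ordLeq subset_UNIV)
    have "{S. (S, T) \<in> ?r \<and> S \<noteq> T} = underS ?r T" by (auto simp: underS_def)
    then show ?thesis using ordLess_ordLeq_trans[OF less le] by simp
  qed
  show thesis by (rule that[of ?r, OF total small])
qed

theorem theorem2p8:
  "\<exists>X. X \<subseteq> inc_inf \<and> X \<in> s0 \<and> X \<notin> w0"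
proof -
  obtain R :: "nat list set rel" where total: "\<And>S T. S = T \<or> (S, T) \<in> R \<or> (T, S) \<in> R"
    and small: "\<And>T. |{S. (S, T) \<in> R \<and> S \<noteq> T}| <o |UNIV :: nat set set|"
    by (rule wellorder_with_small_segments, rule that)
  define below where "below T = {S. (S, T) \<in> R \<and> S \<noteq> T}" for T
  \<comment> \<open>One order on all sets of lists compares willow trees with homogeneous ones.
    Adding \<open>T\<close> covers a homogeneous tree that is the willow tree itself.\<close>
  define K where "K T = {S \<in> below T \<union> {T}. homogeneous S}" for T
  have inf: "\<not> finite (UNIV :: nat set set)" using infinite_UNIV_nat by (simp add: Finite_Set.finite_set)
  have K_small: "|K T| <o |UNIV :: nat set set|" for T
  proof -
    have "|{T}| <o |UNIV :: nat set set|" using inf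
      by (intro finite_ordLess_infinite card_of_Well_order) (simp_all add: Field_card_of)
    then have "|below T \<union> {T}| <o |UNIV :: nat set set|"
      using card_of_Un_ordLess_infinite[OF inf] small unfolding below_def by blast
    moreover have "|K T| \<le>o |below T \<union> {T}|" by (rule card_of_mono1) (auto simp: K_def)
    ultimately show ?thesis using ordLeq_ordLess_trans by blast
  qed
  have "\<exists>x\<in>branches W. \<forall>S\<in>K W. x \<notin> branches S" if "W \<in> willow_trees" for W
    by (rule small_homogeneous_miss_willow[OF that K_small]) (simp add: K_def)
  \<comment> \<open>The choice at \<open>W\<close> refers to earlier trees and not to earlier
    choices, so no transfinite recursion is required.\<close>
  then obtain p where p: "\<And>W. W \<in> willow_trees \<Longrightarrow> p W \<in> branches W"
    and avoid: "\<And>W S. W \<in> willow_trees \<Longrightarrow> S \<in> K W \<Longrightarrow> p W \<notin> branches S"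
    by metis
  define X where "X = p ` willow_trees"
  have X: "X \<subseteq> inc_inf" using p by (auto simp: X_def branches_def)
  have "\<exists>T'\<in>sacks_trees. T' \<subseteq> T \<and> branches T' \<inter> X = {}" if T: "T \<in> sacks_trees" for T
  proof -
    obtain S where S: "S \<in> sacks_trees" "S \<subseteq> T" "homogeneous S"
      using homogeneous_dense[OF T] by blast
    obtain S' where S': "S' \<in> sacks_trees" "S' \<subseteq> S" "branches S' \<inter> p ` below S = {}"
      using sacks_subtree_avoids_small[OF S(1), of "below S" p] small unfolding below_def by blast
    \<comment> \<open>Since \<open>p W\<close> avoids every tree in \<open>K W\<close>, the
      homogeneous tree \<open>S\<close> is neither \<open>W\<close> nor before \<open>W\<close>;
      totality puts \<open>W\<close> before \<open>S\<close>.\<close>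
    have "W \<in> below S" if "W \<in> willow_trees" "p W \<in> branches S" for W
      using avoid[OF that(1), of S] that(2) S(3) total[of S W] by (auto simp: K_def below_def)
    moreover have "branches S' \<subseteq> branches S" using S'(2) by (auto simp: branches_def)
    ultimately have "branches S' \<inter> X = {}" using S'(3) unfolding X_def by blast
    moreover have "S' \<subseteq> T" using S'(2) S(2) by (rule subset_trans)
    ultimately show ?thesis using S'(1) by blast
  qed
  then have "X \<in> s0" using X unfolding s0_def assoc_ideal_def by blast
  moreover have "X \<notin> w0"
  proof
    \<comment> \<open>Membership in \<open>w0\<close> yields a missed willow tree only from a given
      one, so some willow tree has to be exhibited.\<close>
    have "block_seq (\<lambda>n. {n})" by (simp add: block_seq_def)
    then have "willow_tree (\<lambda>n. {n}) (\<lambda>_. 0) \<in> willow_trees" unfolding willow_trees_def by blast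
    moreover assume "X \<in> w0"
    ultimately obtain W where "W \<in> willow_trees" "branches W \<inter> X = {}"
      unfolding w0_def assoc_ideal_def by blast
    then show False using p unfolding X_def by blast
  qed
  ultimately show ?thesis using X by blast
qed

end
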